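(* Consider the weighted least squares model with design matrix $\mathbf X\in\mathbb R^{n\times p}$ and fitting weight matrix $\mathbf Q=\mathrm{diag}(q_1,\dots,q_n)$, $q_i>0$, evaluated with the weights $w=1/\tau$, and regard its predictive model degrees of freedom $\mathrm{df}_{\rm R}$ as a function of the weight vector $\mathbf q=(q_1,\dots,q_n)^\top=\mathrm{diag}(\mathbf Q)$. Then its gradient with respect to $\mathbf q$ is $$\frac{\partial\,\mathrm{df}_{\rm R}}{\partial\mathbf q}=n\,\mathrm{diag}\Big((\mathbf I_n-\mathbf H)\,\mathbf T\mathbf Q\mathbf X(\mathbf X^\top\mathbf Q\mathbf X)^{-1}\mathbf R(\mathbf X^\top\mathbf Q\mathbf X)^{-1}\mathbf X^\top\Big),$$ where $\mathbf H=\mathbf X(\mathbf X^\top\mathbf Q\mathbf X)^{-1}\mathbf X^\top\mathbf Q$.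
   Context: Setting: $\mathbf X\in\mathbb R^{n\times p}$ has full column rank and rows $\mathbf x_1^\top,\dots,\mathbf x_n^\top$. The responses $\mathbf y\in\mathbb R^n$ satisfy $\mathrm{Var}(\mathbf y\mid\mathbf X)=\sigma_\varepsilon^2\mathbf T$ with $\sigma_\varepsilon^2>0$ and $\mathbf T=\mathrm{diag}(\tau_1,\dots,\tau_n)$, $\tau_i=\tau(\mathbf x_i)>0$. The weighted least squares model with fitting weights $\mathbf Q$ minimizes $(\mathbf y-\mathbf X\mathbf b)^\top\mathbf Q(\mathbf y-\mathbf X\mathbf b)$ over $\mathbf b\in\mathbb R^p$. The evaluation weights are $w=1/\tau$, i.e. $w_i=1/\tau_i$, $w_\ast=1/\tau(\mathbf x_\ast)$, where $\mathbf x_\ast$ is a new covariate vector, an independent copy of $\mathbf x_i$; $\bar w=\frac1n\sum_{i=1}^n w_i$ and $\zeta_\tau=1/\bar w=\big(\frac1n\sum_{i=1}^n\tau_i^{-1}\big)^{-1}$. Put $\boldsymbol\Sigma=\mathrm E(w_\ast\mathbf x_\ast\mathbf x_\ast^\top)/\bar w$ (the expectation is over $\mathbf x_\ast$ only) and $$\mathbf R=\boldsymbol\Sigma-\frac{1}{n\bar w}\mathbf X^\top\mathbf T^{-1}\mathbf X.$$ The predictive model degrees of freedom of this model is $$\mathrm{df}_{\rm R}=\zeta_\tau p+\frac n2\mathrm{tr}\big[(\mathbf X^\top\mathbf Q\mathbf X)^{-1}\mathbf X^\top\mathbf Q\mathbf T\mathbf Q\mathbf X(\mathbf X^\top\mathbf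 Q\mathbf X)^{-1}\mathbf R\big].$$ The quantities $\mathbf X,\mathbf T,\bar w,\boldsymbol\Sigma,\mathbf R$ do not depend on $\mathbf q$. For a square matrix $\mathbf B$, $\mathrm{diag}(\mathbf B)$ denotes the vector of its diagonal entries. *)

theory Defs
  imports "HOL-Probability.Probability"
begin

definition diag_mat :: "real ^ 'n \<Rightarrow> real ^ 'n ^ 'n" where
  "diag_mat v = (\<chi> i j. if i = j then v $ i else 0)"

definition diag_vec :: "real ^ 'n ^ 'n \<Rightarrow> real ^ 'n" where
  "diag_vec B = (\<chi> i. B $ i $ i)"

definition outer :: "real ^ 'm \<Rightarrow> real ^ 'm \<Rightarrow> real ^ 'm ^ 'm" where
  "outer x y = (\<chi> i j. x $ i * y $ j)"

definition covariance_matrix :: "(real ^ 'n) measure \<Rightarrow> real ^ 'n ^ 'n" where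
  "covariance_matrix M =
     (let \<mu> = integral\<^sup>L M (\<lambda>y. y) in integral\<^sup>L M (\<lambda>y. outer (y - \<mu>) (y - \<mu>)))"

text \<open>
  A design matrix \<open>X\<close> has type \<open>real ^ 'p ^ 'n\<close>: there are \<open>CARD('n)\<close> observations, and
  \<open>X $ i\<close> is the covariate vector of observation \<open>i\<close>. The measure \<open>D\<close> is the common law of the
  covariate vectors; as the new covariate vector is independent of \<open>X\<close>, an expectation over it
  alone is an integral with respect to \<open>D\<close> in which \<open>X\<close> is a constant.
\<close>

definition var_mat :: "(real ^ 'p \<Rightarrow> real) \<Rightarrow> real ^ 'p ^ 'n \<Rightarrow> real ^ 'n ^ 'n" where
  "var_mat \<tau> X = diag_mat (\<chi> i. \<tau> (X $ i))"

definition mean_weight :: "(real ^ 'p \<Rightarrow> real) \<Rightarrow> real ^ 'p ^ 'n \<Rightarrow> real" where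
  "mean_weight \<tau> X = (\<Sum>i\<in>UNIV. 1 / \<tau> (X $ i)) / real CARD('n)"

definition zeta :: "(real ^ 'p \<Rightarrow> real) \<Rightarrow> real ^ 'p ^ 'n \<Rightarrow> real" where
  "zeta \<tau> X = 1 / mean_weight \<tau> X"

definition Sigma_mat ::
    "(real ^ 'p) measure \<Rightarrow> (real ^ 'p \<Rightarrow> real) \<Rightarrow> real ^ 'p ^ 'n \<Rightarrow> real ^ 'p ^ 'p" where
  "Sigma_mat D \<tau> X =
     (1 / mean_weight \<tau> X) *\<^sub>R integral\<^sup>L D (\<lambda>x. (1 / \<tau> x) *\<^sub>R outer x x)"

definition R_mat ::
    "(real ^ 'p) measure \<Rightarrow> (real ^ 'p \<Rightarrow> real) \<Rightarrow> real ^ 'p ^ 'n \<Rightarrow> real ^ 'p ^ 'p" where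
  "R_mat D \<tau> X =
     Sigma_mat D \<tau> X
     - (1 / (real CARD('n) * mean_weight \<tau> X)) *\<^sub>R
         (transpose X ** matrix_inv (var_mat \<tau> X) ** X)"

definition hat_mat :: "real ^ 'p ^ 'n \<Rightarrow> real ^ 'n ^ 'n \<Rightarrow> real ^ 'n ^ 'n" where
  "hat_mat X Q = X ** matrix_inv (transpose X ** Q ** X) ** transpose X ** Q"

definition df_R ::
    "(real ^ 'p) measure \<Rightarrow> (real ^ 'p \<Rightarrow> real) \<Rightarrow> real ^ 'p ^ 'n \<Rightarrow> real ^ 'n ^ 'n \<Rightarrow> real" where
  "df_R D \<tau> X Q =
     zeta \<tau> X * real CARD('p)
     + real CARD('n) / 2 *
       trace (matrix_inv (transpose X ** Q ** X) ** transpose X ** Q ** var_mat \<tau> X ** Q ** X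
              ** matrix_inv (transpose X ** Q ** X) ** R_mat D \<tau> X)"

end

theory Submission
  imports Defs
begin

text \<open>
  Put \<open>M = (X\<^sup>T Q X)\<^sup>-\<^sup>1\<close> and \<open>U = M X\<^sup>T Q\<close>, so that the trace in the degrees of freedom is
  \<open>tr (U T U\<^sup>T R)\<close>. In the direction \<open>h\<close> one has \<open>dM = - M X\<^sup>T diag(h) X M\<close>, hence
  \<open>dU = M X\<^sup>T diag(h) (I - H)\<close>. As \<open>T\<close> and \<open>R\<close> are symmetric, the two terms of the product rule
  are traces of transposes of each other, and the derivative \<open>2 tr (dU T U\<^sup>T R)\<close> becomes, by cyclicity,
  \<open>2 tr (diag(h) (I - H) T U\<^sup>T R M X\<^sup>T)\<close>, which is linear in \<open>h\<close> with the stated coefficients.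
\<close>

section \<open>Linear and bilinear matrix operations\<close>

text \<open>In finite dimension bilinearity already gives boundedness. The product rule for
  matrix-valued functions and the distributive laws below are instances of this fact.\<close>

lemma bounded_bilinear_matrix_mult:
  "bounded_bilinear ((**) :: real ^ 'm ^ 'n \<Rightarrow> real ^ 'k ^ 'm \<Rightarrow> real ^ 'k ^ 'n)"
  unfolding bilinear_conv_bounded_bilinear[symmetric]
  by (auto simp: bilinear_def linear_iff matrix_matrix_mult_def vec_eq_iff algebra_simps
      sum.distrib sum_distrib_left)

lemmas has_derivative_matrix_mult = bounded_bilinear.FDERIV[OF bounded_bilinear_matrix_mult]

lemmas matrix_add_rdistrib = bounded_bilinear.add_left[OF bounded_bilinear_matrix_mult]

lemmas matrix_diff_ldistrib = bounded_bilinear.diff_right[OF bounded_bilinear_matrix_mult]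

lemmas matrix_diff_rdistrib = bounded_bilinear.diff_left[OF bounded_bilinear_matrix_mult]

lemmas matrix_minus_left = bounded_bilinear.minus_left[OF bounded_bilinear_matrix_mult]

lemmas matrix_minus_right = bounded_bilinear.minus_right[OF bounded_bilinear_matrix_mult]

lemma bounded_linear_trace: "bounded_linear (trace :: real ^ 'n ^ 'n \<Rightarrow> real)"
  by (intro linear_conv_bounded_linear[THEN iffD1])
    (simp add: linear_iff trace_add, simp add: trace_def sum_distrib_left)

lemma bounded_linear_transpose: "bounded_linear (transpose :: real ^ 'm ^ 'n \<Rightarrow> real ^ 'n ^ 'm)"
  by (intro linear_conv_bounded_linear[THEN iffD1])
    (simp add: linear_iff transpose_def vec_eq_iff)

lemma bounded_linear_diag_mat: "bounded_linear (diag_mat :: real ^ 'n \<Rightarrow> real ^ 'n ^ 'n)"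
  by (intro linear_conv_bounded_linear[THEN iffD1])
    (simp add: linear_iff diag_mat_def vec_eq_iff)

lemma trace_transpose: "trace (transpose A) = trace A"
  by (simp add: trace_def transpose_def)

text \<open>This reads off a gradient: the linear functional sending \<open>h\<close> to the trace
  is represented by the diagonal of \<open>B\<close>.\<close>

lemma trace_diag_mat_mult: "trace (diag_mat h ** B) = h \<bullet> diag_vec B"
  by (simp add: trace_def diag_mat_def diag_vec_def matrix_matrix_mult_def inner_vec_def
      if_distrib[of "\<lambda>x. x * _"] cong: if_cong)

lemma transpose_diag_mat [simp]: "transpose (diag_mat v) = diag_mat v"
  by (auto simp: transpose_def diag_mat_def vec_eq_iff)

lemma diag_mat_mult_vec: "diag_mat v *v x = (\<chi> i. v $ i * x $ i)"
  by (simp add: diag_mat_def matrix_vector_mult_def vec_eq_iff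
      if_distrib[of "\<lambda>x. x * _"] cong: if_cong)

lemma invertible_diag_mat:
  assumes "\<And>i. v $ i \<noteq> 0"
  shows "invertible (diag_mat v)"
  using assms unfolding invertible_left_inverse matrix_left_invertible_ker
  by (simp add: diag_mat_mult_vec vec_eq_iff)

section \<open>Matrix inverses and their symmetry\<close>

lemma
  assumes "invertible A"
  shows matrix_inv_right: "A ** matrix_inv A = mat 1"
    and matrix_inv_left: "matrix_inv A ** A = mat 1"
proof -
  have "A ** matrix_inv A = mat 1 \<and> matrix_inv A ** A = mat 1"
    using assms unfolding matrix_inv_def invertible_def by (rule someI_ex)
  then show "A ** matrix_inv A = mat 1" "matrix_inv A ** A = mat 1" by auto
qed

text \<open>Transposing \<open>A ** matrix_inv A = mat 1\<close> makes the transposed inverse a left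
  inverse of the symmetric \<open>A\<close>, and a left inverse coincides with the inverse.\<close>

lemma transpose_matrix_inv:
  fixes A :: "real ^ 'n ^ 'n"
  assumes "invertible A" "transpose A = A"
  shows "transpose (matrix_inv A) = matrix_inv A"
proof -
  have "transpose (matrix_inv A) ** A = mat 1"
    using matrix_inv_right[OF assms(1)] assms(2) by (metis matrix_transpose_mul transpose_mat)
  then have "transpose (matrix_inv A) ** A ** matrix_inv A = matrix_inv A"
    by simp
  then show ?thesis
    by (simp add: matrix_mul_assoc[symmetric] matrix_inv_right[OF assms(1)])
qed

section \<open>Differentiating determinant and inverse\<close>

text \<open>The Leibniz formula is a finite signed sum of products of entries. A general
  \<open>F\<close> covers both the determinant itself and the numerators in Cramer's rule.\<close>

lemma det_differentiable:
  fixes F :: "'a::real_normed_vector \<Rightarrow> real ^ 'n ^ 'n"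
  assumes "\<And>i j. (\<lambda>x. F x $ i $ j) differentiable (at a)"
  shows "(\<lambda>x. det (F x)) differentiable (at a)"
proof -
  have "(\<lambda>x. \<Prod>i\<in>UNIV. F x $ i $ p i) differentiable (at a)" for p :: "'n \<Rightarrow> 'n"
  proof -
    have "\<forall>i. \<exists>D. ((\<lambda>x. F x $ i $ p i) has_derivative D) (at a)"
      using assms unfolding differentiable_def by blast
    then obtain D where "\<And>i. ((\<lambda>x. F x $ i $ p i) has_derivative D i) (at a)"
      by metis
    then show ?thesis
      unfolding differentiable_def by (intro exI) (rule has_derivative_prod)
  qed
  then show ?thesis
    unfolding det_def by (intro differentiable_sum differentiable_mult differentiable_const) auto
qed

lemma vec_nth_nth_differentiable:
  "(\<lambda>A :: real ^ 'n ^ 'm. A $ i $ j) differentiable (at A)"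
  by (intro bounded_linear_imp_differentiable bounded_linear_compose[OF bounded_linear_vec_nth]
      bounded_linear_vec_nth)

text \<open>This is where the continuous determinant is nonzero. Openness allows identities valid
  only for invertible matrices to be used when differentiating at such a matrix.\<close>

lemma open_invertible: "open {A :: real ^ 'n ^ 'n. invertible A}"
proof -
  have "continuous_on UNIV (det :: real ^ 'n ^ 'n \<Rightarrow> real)"
    using det_differentiable[of "\<lambda>x. x"] vec_nth_nth_differentiable
    by (intro continuous_at_imp_continuous_on ballI differentiable_imp_continuous_within) blast
  then show ?thesis
    unfolding invertible_det_nz by (intro open_Collect_neq) auto
qed

text \<open>Cramer's rule makes every entry of the inverse a quotient of polynomials in the entries.\<close>

lemma matrix_inv_differentiable:
  fixes A :: "real ^ 'n ^ 'n"
  assumes "invertible A"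
  shows "matrix_inv differentiable (at A)"
proof -
  \<comment> \<open>\<open>C B k l\<close> is \<open>B\<close> with column \<open>k\<close> replaced
    by the unit vector of index \<open>l\<close>, the numerator matrix of Cramer's rule;
    \<open>G\<close> collects the resulting quotients.\<close>
  define C where "C = (\<lambda>(B :: real ^ 'n ^ 'n) k l.
    (\<chi> i j. if j = k then (axis l 1 :: real ^ 'n) $ i else B $ i $ j) :: real ^ 'n ^ 'n)"
  define G where "G = (\<lambda>B. (\<chi> k l. det (C B k l) / det B) :: real ^ 'n ^ 'n)"
  have det_diff: "(det :: real ^ 'n ^ 'n \<Rightarrow> real) differentiable (at A)"
    using det_differentiable[of "\<lambda>x. x"] vec_nth_nth_differentiable by blast
  have G_eq: "matrix_inv B = G B" if "det B \<noteq> 0" for B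
  proof -
    \<comment> \<open>Each column of the inverse solves a linear system with a unit vector on the
      right, which is the form Cramer's rule needs.\<close>
    have "B *v column l (matrix_inv B) = axis l 1" for l
    proof -
      have "B *v column l (matrix_inv B) = column l (B ** matrix_inv B)"
        by (simp add: column_def matrix_vector_mult_def matrix_matrix_mult_def vec_eq_iff)
      also have "\<dots> = axis l 1"
        using that by (simp add: matrix_inv_right invertible_det_nz column_def mat_def axis_def vec_eq_iff)
      finally show ?thesis .
    qed
    then have "column l (matrix_inv B) = (\<chi> k. det (C B k l) / det B)" for l
      using cramer[OF that] unfolding C_def by blast
    then show ?thesis
      unfolding G_def by (simp add: vec_eq_iff column_def)
  qed
  have "(\<lambda>B. C B k l $ i $ j) differentiable (at A)" for k l i j
    by (cases "j = k") (simp_all add: C_def vec_nth_nth_differentiable)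
  then have "(\<lambda>B. det (C B k l) / det B) differentiable (at A)" for k l
    using assms det_diff
    by (intro differentiable_divide det_differentiable[of "\<lambda>B. C B k l"]) (auto simp: invertible_det_nz)
  then have "(\<lambda>B. G B \<bullet> b) differentiable (at A)" if "b \<in> Basis" for b
    using that by (auto simp: Basis_vec_def inner_axis G_def)
  then have "G differentiable (at A)"
    by (subst differentiable_componentwise_within) blast
  then obtain D where "(G has_derivative D) (at A)"
    unfolding differentiable_def by blast
  \<comment> \<open>\<open>matrix_inv\<close> agrees with \<open>G\<close> on the open set of
    invertible matrices around \<open>A\<close>, so the derivative carries over.\<close>
  then have "(matrix_inv has_derivative D) (at A)"
    by (rule has_derivative_transform_within_open[OF _ open_invertible])
      (auto simp: assms G_eq invertible_det_nz[symmetric])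
  then show ?thesis
    unfolding differentiable_def by blast
qed

text \<open>Once a derivative \<open>D\<close> is known to exist, its value is forced:
  \<open>matrix_inv B ** B\<close> is constant near \<open>A\<close>, so the product rule gives a
  linear equation for \<open>D H\<close>, solved by multiplying with the inverse of \<open>A\<close>
  on the right.\<close>

lemma has_derivative_matrix_inv:
  fixes A :: "real ^ 'n ^ 'n"
  assumes "invertible A"
  shows "(matrix_inv has_derivative (\<lambda>H. - (matrix_inv A ** H ** matrix_inv A))) (at A)"
proof -
  obtain D where D: "(matrix_inv has_derivative D) (at A)"
    using matrix_inv_differentiable[OF assms] unfolding differentiable_def by blast
  have "((\<lambda>B. matrix_inv B ** B) has_derivative (\<lambda>H. matrix_inv A ** H + D H ** A)) (at A)"
    by (rule has_derivative_matrix_mult[OF D has_derivative_ident])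
  moreover have "((\<lambda>B. matrix_inv B ** B) has_derivative (\<lambda>H. 0)) (at A)"
    by (rule has_derivative_transform_within_open[OF has_derivative_const open_invertible])
      (auto simp: assms matrix_inv_left)
  ultimately have "(\<lambda>H. matrix_inv A ** H + D H ** A) = (\<lambda>H. 0)"
    by (rule has_derivative_unique)
  then have "matrix_inv A ** H + D H ** A = 0" for H
    by meson
  then have "D H ** A ** matrix_inv A = - (matrix_inv A ** H) ** matrix_inv A" for H
    by (metis add.commute eq_neg_iff_add_eq_0)
  then have "D H = - (matrix_inv A ** H ** matrix_inv A)" for H
    by (simp add: matrix_mul_assoc[symmetric] matrix_inv_right[OF assms] matrix_minus_left)
  then show ?thesis
    using D by presburger
qed

section \<open>Weighted Gram matrix and symmetry of \<open>R_mat\<close>\<close>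

text \<open>For \<open>v\<close> in the kernel the quadratic form is a sum of the squares of the
  entries of \<open>X *v v\<close> with positive weights, so \<open>X *v v\<close> vanishes; full
  column rank then gives \<open>v = 0\<close>.\<close>

lemma invertible_weighted_gram:
  fixes X :: "real ^ 'p ^ 'n"
  assumes "rank X = CARD('p)" and "\<And>i. q $ i > 0"
  shows "invertible (transpose X ** diag_mat q ** X)"
  unfolding invertible_left_inverse matrix_left_invertible_ker
proof (intro allI impI)
  fix v assume v: "(transpose X ** diag_mat q ** X) *v v = 0"
  have "0 = v \<bullet> (transpose X *v (diag_mat q *v (X *v v)))"
    using v by (simp add: matrix_vector_mul_assoc matrix_mul_assoc del: transpose_matrix_vector)
  also have "\<dots> = (X *v v) \<bullet> (diag_mat q *v (X *v v))"
    by (metis dot_lmul_matrix vector_transpose_matrix)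
  also have "\<dots> = (\<Sum>i\<in>UNIV. q $ i * ((X *v v) $ i)\<^sup>2)"
    by (simp add: diag_mat_mult_vec inner_vec_def power2_eq_square algebra_simps)
  finally have "\<forall>i. q $ i * ((X *v v) $ i)\<^sup>2 = 0"
    by (subst (asm) eq_commute, subst (asm) sum_nonneg_eq_0_iff) (auto simp: assms less_imp_le)
  then have "X *v v = X *v 0"
    using assms(2) by (simp add: vec_eq_iff) (metis less_irrefl)
  then show "v = 0"
    using assms(1) unfolding full_rank_injective by (rule injD[rotated])
qed

text \<open>Integrability lets the transpose pass under the integral, whose integrand is symmetric.
  The other term is symmetric because the positive diagonal \<open>var_mat\<close> has a symmetric
  inverse.\<close>

lemma transpose_R_mat:
  fixes X :: "real ^ 'p ^ 'n"
  assumes "\<And>i. \<tau> (X $ i) > 0" "integrable D (\<lambda>x. (1 / \<tau> x) *\<^sub>R outer x x)"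
  shows "transpose (R_mat D \<tau> X) = R_mat D \<tau> X"
proof -
  have "transpose (integral\<^sup>L D (\<lambda>x. (1 / \<tau> x) *\<^sub>R outer x x)) =
      integral\<^sup>L D (\<lambda>x. transpose ((1 / \<tau> x) *\<^sub>R outer x x))"
    by (rule integral_bounded_linear[OF bounded_linear_transpose assms(2), symmetric])
  also have "(\<lambda>x. transpose ((1 / \<tau> x) *\<^sub>R outer x x)) = (\<lambda>x. (1 / \<tau> x) *\<^sub>R outer x x)"
    by (simp add: fun_eq_iff transpose_def outer_def vec_eq_iff mult.commute)
  finally have Sigma: "transpose (Sigma_mat D \<tau> X) = Sigma_mat D \<tau> X"
    by (simp add: Sigma_mat_def transpose_scalar)
  have "transpose (matrix_inv (var_mat \<tau> X)) = matrix_inv (var_mat \<tau> X)"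
    unfolding var_mat_def using assms(1)
    by (intro transpose_matrix_inv invertible_diag_mat) (auto simp: less_imp_neq[symmetric])
  then have "transpose (transpose X ** matrix_inv (var_mat \<tau> X) ** X)
      = transpose X ** matrix_inv (var_mat \<tau> X) ** X"
    by (simp add: matrix_transpose_mul matrix_mul_assoc)
  with Sigma show ?thesis
    unfolding R_mat_def
    by (simp add: linear_diff[OF bounded_linear.linear[OF bounded_linear_transpose]] transpose_scalar)
qed

section \<open>Gradient of the degrees of freedom\<close>

theorem theorem4p3:
  fixes X :: "real ^ 'p ^ 'n"
    and \<tau> :: "real ^ 'p \<Rightarrow> real"
    and D :: "(real ^ 'p) measure"
    and Y :: "(real ^ 'n) measure"
    and \<sigma>\<epsilon> :: real
    and q :: "real ^ 'n"
  assumes full_column_rank: "rank X = CARD('p)"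
    and covariate_law: "prob_space D" "sets D = sets borel"
    and tau_pos: "\<And>i. \<tau> (X $ i) > 0" "AE x in D. \<tau> x > 0"
    and Sigma_exists: "integrable D (\<lambda>x. (1 / \<tau> x) *\<^sub>R outer x x)"
    and response_law_given_X: "prob_space Y" "sets Y = sets borel"
      "integrable Y (\<lambda>y. (norm y)\<^sup>2)"
    and response_variance: "\<sigma>\<epsilon>\<^sup>2 > 0" "covariance_matrix Y = \<sigma>\<epsilon>\<^sup>2 *\<^sub>R var_mat \<tau> X"
    and weights_pos: "\<And>i. q $ i > 0"
  shows "GDERIV (\<lambda>q. df_R D \<tau> X (diag_mat q)) q :>
    real CARD('n) *\<^sub>R
      diag_vec ((mat 1 - hat_mat X (diag_mat q)) ** var_mat \<tau> X ** diag_mat q ** X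
        ** matrix_inv (transpose X ** diag_mat q ** X) ** R_mat D \<tau> X
        ** matrix_inv (transpose X ** diag_mat q ** X) ** transpose X)"
proof -
  define T where "T = var_mat \<tau> X"
  define R where "R = R_mat D \<tau> X"
  define M where "M = (\<lambda>q. matrix_inv (transpose X ** diag_mat q ** X))"
  define Q where "Q = diag_mat q"
  define E where "E = mat 1 - hat_mat X Q"
  define U where "U = M q ** transpose X ** Q"
  define dU where "dU = (\<lambda>h. M q ** transpose X ** diag_mat h ** E)"
  have inv: "invertible (transpose X ** Q ** X)"
    unfolding Q_def by (rule invertible_weighted_gram[OF full_column_rank weights_pos])
  have T_sym: "transpose T = T"
    by (simp add: T_def var_mat_def)
  have R_sym: "transpose R = R"
    unfolding R_def by (rule transpose_R_mat[OF tau_pos(1) Sigma_exists])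
  have Q_sym: "transpose Q = Q"
    by (simp add: Q_def)
  have M_sym: "transpose (M q) = M q"
    unfolding M_def Q_def[symmetric]
    by (rule transpose_matrix_inv[OF inv]) (simp add: matrix_transpose_mul Q_sym matrix_mul_assoc)
  have diag': "(diag_mat has_derivative diag_mat) (at q)"
    by (rule bounded_linear_imp_has_derivative[OF bounded_linear_diag_mat])
  have "((\<lambda>q. transpose X ** diag_mat q ** X) has_derivative
      (\<lambda>h. transpose X ** diag_mat h ** X)) (at q)"
    by (rule has_derivative_eq_rhs,
        rule has_derivative_matrix_mult[OF has_derivative_matrix_mult[OF has_derivative_const diag']
          has_derivative_const])
      (simp add: bounded_bilinear.zero_left[OF bounded_bilinear_matrix_mult]
        bounded_bilinear.zero_right[OF bounded_bilinear_matrix_mult])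
  from has_derivative_compose[OF this, of matrix_inv] has_derivative_matrix_inv[OF inv]
  have M': "(M has_derivative (\<lambda>h. - (M q ** (transpose X ** diag_mat h ** X) ** M q))) (at q)"
    unfolding M_def Q_def by blast
  \<comment> \<open>The term from \<open>M'\<close> ends in
    \<open>X ** M q ** transpose X ** Q\<close>, the hat matrix, so both terms combine into the
    single factor \<open>E\<close>.\<close>
  have U': "((\<lambda>q. M q ** transpose X ** diag_mat q) has_derivative dU) (at q)"
    by (rule has_derivative_eq_rhs,
        rule has_derivative_matrix_mult[OF has_derivative_matrix_mult[OF M' has_derivative_const] diag'])
      (simp add: fun_eq_iff dU_def E_def hat_mat_def M_def Q_def matrix_diff_ldistrib
        matrix_minus_left matrix_mul_assoc
        bounded_bilinear.zero_right[OF bounded_bilinear_matrix_mult])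
  \<comment> \<open>\<open>M_sym\<close> concerns the fixed point \<open>q\<close> only, so this
    factor is differentiated by the product rule; symmetry at \<open>q\<close> then identifies the
    result as \<open>transpose (dU h)\<close>.\<close>
  have V': "((\<lambda>q. diag_mat q ** X ** M q) has_derivative (\<lambda>h. transpose (dU h))) (at q)"
    by (rule has_derivative_eq_rhs,
        rule has_derivative_matrix_mult[OF has_derivative_matrix_mult[OF diag' has_derivative_const] M'])
      (simp add: fun_eq_iff dU_def E_def hat_mat_def matrix_transpose_mul M_sym Q_sym
        linear_diff[OF bounded_linear.linear[OF bounded_linear_transpose]] matrix_diff_rdistrib
        matrix_minus_right matrix_mul_assoc Q_def[symmetric]
        M_def[unfolded fun_eq_iff, rule_format, of q, folded Q_def, symmetric]
        bounded_bilinear.zero_right[OF bounded_bilinear_matrix_mult])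
  have V_eq: "Q ** X ** M q = transpose U"
    by (simp add: U_def matrix_transpose_mul M_sym Q_sym matrix_mul_assoc)
  \<comment> \<open>Here \<open>q\<close> is bound anew and arbitrary, so the equation rewrites the
    whole function, grouped into the factors of \<open>U'\<close> and \<open>V'\<close>.\<close>
  have df: "df_R D \<tau> X (diag_mat q) = zeta \<tau> X * real CARD('p) + real CARD('n) / 2 *
      trace ((M q ** transpose X ** diag_mat q) ** T ** (diag_mat q ** X ** M q) ** R)" for q
    by (simp add: df_R_def M_def T_def R_def matrix_mul_assoc)
  have "((\<lambda>q. (M q ** transpose X ** diag_mat q) ** T ** (diag_mat q ** X ** M q) ** R)
      has_derivative (\<lambda>h. U ** T ** transpose (dU h) ** R + dU h ** T ** transpose U ** R)) (at q)"
    by (rule has_derivative_eq_rhs,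
        rule has_derivative_matrix_mult[OF has_derivative_matrix_mult[OF
          has_derivative_matrix_mult[OF U' has_derivative_const] V'] has_derivative_const])
      (simp add: fun_eq_iff U_def[symmetric] Q_def[symmetric] V_eq matrix_add_rdistrib
        bounded_bilinear.zero_right[OF bounded_bilinear_matrix_mult])
  from bounded_linear.has_derivative[OF bounded_linear_trace this]
  have "((\<lambda>q. df_R D \<tau> X (diag_mat q)) has_derivative
      (\<lambda>h. real CARD('n) / 2 * trace (U ** T ** transpose (dU h) ** R + dU h ** T ** transpose U ** R)))
      (at q)"
    unfolding df by (auto intro!: derivative_eq_intros)
  \<comment> \<open>The two traces are equal, so their sum cancels the factor one half.\<close>
  moreover have "real CARD('n) / 2 * trace (U ** T ** transpose (dU h) ** R + dU h ** T ** transpose U ** R)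
      = h \<bullet> (real CARD('n) *\<^sub>R diag_vec (E ** T ** Q ** X ** M q ** R ** M q ** transpose X))" for h
  proof -
    have "trace (U ** T ** transpose (dU h) ** R) = trace (transpose (U ** T ** transpose (dU h) ** R))"
      by (rule trace_transpose[symmetric])
    also have "\<dots> = trace (R ** (dU h ** T ** transpose U))"
      by (simp add: matrix_transpose_mul T_sym R_sym matrix_mul_assoc)
    also have "\<dots> = trace (dU h ** T ** transpose U ** R)"
      by (rule trace_mul_sym)
    finally have first: "trace (U ** T ** transpose (dU h) ** R) = trace (dU h ** T ** transpose U ** R)" .
    \<comment> \<open>Splitting off \<open>M q ** transpose X\<close> lets cyclicity move it to the
      end, leaving \<open>diag_mat h\<close> in front as \<open>trace_diag_mat_mult\<close>
      requires.\<close>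
    have "trace (dU h ** T ** transpose U ** R)
        = trace ((M q ** transpose X) ** (diag_mat h ** E ** T ** Q ** X ** M q ** R))"
      by (simp add: dU_def V_eq[symmetric] matrix_mul_assoc)
    also have "\<dots> = trace ((diag_mat h ** E ** T ** Q ** X ** M q ** R) ** (M q ** transpose X))"
      by (rule trace_mul_sym)
    also have "\<dots> = trace (diag_mat h ** (E ** T ** Q ** X ** M q ** R ** M q ** transpose X))"
      by (simp add: matrix_mul_assoc)
    also have "\<dots> = h \<bullet> diag_vec (E ** T ** Q ** X ** M q ** R ** M q ** transpose X)"
      by (rule trace_diag_mat_mult)
    finally show ?thesis
      using first by (simp add: trace_add)
  qed
  ultimately show ?thesis
    unfolding gderiv_def E_def T_def R_def M_def Q_def by simp
qed

end
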